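(* Let $\mathcal{H}$ be a separable infinite-dimensional complex Hilbert space, $k\ge1$ an integer, and let $T\in\mathcal{B}(\mathcal{H})$ be non-isometric and such that there exists an orthonormal basis $\{e_n\}_{n\ge0}$ of $\mathcal{H}$ with respect to which $T=S_k+u\otimes v$, where $S_ke_n=e_{n+k}$ for all $n\ge0$ and $u,v\in\mathcal{H}$ are nonzero. Suppose $v,S_k^*u$ are linearly dependent. Then $T$ is quasinormal if and only if $v$ is an eigenvector of $S_k^*$ and $$(1+\langle S_k^*u,v\rangle)\,\langle S_kv,g_i\rangle+\|v\|^2\sum_{n=0}^{k-1}\langle u,e_n\rangle\langle e_n,g_i\rangle=0\qquad\text{for all } i=1,\ldots,m\ (\le k),$$ where $\{g_1,\ldots,g_m\}$ is an orthonormal basis of $\ker(I-T^*T)\ominus S_k\ker(I-T^*T)$.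
   Context: Inner products are linear in the first variable, and $(u\otimes v)f=\langle f,v\rangle u$. An operator $T$ is quasinormal if $T(T^*T)=(T^*T)T$. An eigenvector is a nonzero vector with any complex eigenvalue (zero allowed). For a closed $S_k$-invariant subspace $\mathcal{K}$, $\mathcal{K}\ominus S_k\mathcal{K}=\mathcal{K}\cap(S_k\mathcal{K})^\perp$, which has dimension at most $k$; the displayed condition is to be read for $\ker(I-T^*T)$ being $S_k$-invariant. *)

theory Defs
  imports "HOL-Analysis.Analysis"
begin

text \<open>Complex Hilbert spaces. The inner product is linear in the first variable. Completeness and
  the norm topology come from the superclass \<^class>\<open>banach\<close>.\<close>

class complex_hilbert_space = banach +
  fixes scaleC :: "complex \<Rightarrow> 'a \<Rightarrow> 'a"  (infixr \<open>*\<^sub>C\<close> 75)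
    and cinner :: "'a \<Rightarrow> 'a \<Rightarrow> complex"
  assumes scaleC_add_right: "c *\<^sub>C (x + y) = c *\<^sub>C x + c *\<^sub>C y"
    and scaleC_add_left: "(c + d) *\<^sub>C x = c *\<^sub>C x + d *\<^sub>C x"
    and scaleC_scaleC: "c *\<^sub>C d *\<^sub>C x = (c * d) *\<^sub>C x"
    and scaleC_one: "1 *\<^sub>C x = x"
    and scaleR_scaleC: "r *\<^sub>R x = complex_of_real r *\<^sub>C x"
    and cinner_commute: "cinner x y = cnj (cinner y x)"
    and cinner_add_left: "cinner (x + y) z = cinner x z + cinner y z"
    and cinner_scaleC_left: "cinner (c *\<^sub>C x) y = c * cinner x y"
    and norm_eq_sqrt_cinner: "norm x = sqrt (Re (cinner x x))"

lemma vector_space_scaleC: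
  "vector_space (scaleC :: complex \<Rightarrow> 'a \<Rightarrow> 'a::complex_hilbert_space)"
  by unfold_locales
    (simp_all add: scaleC_add_right scaleC_add_left scaleC_scaleC scaleC_one)

abbreviation cspan :: "'a::complex_hilbert_space set \<Rightarrow> 'a set" where
  "cspan \<equiv> module.span scaleC"

definition bounded_clinear :: "('a::complex_hilbert_space \<Rightarrow> 'a) \<Rightarrow> bool" where
  "bounded_clinear A \<longleftrightarrow> bounded_linear A \<and> (\<forall>c x. A (c *\<^sub>C x) = c *\<^sub>C A x)"

definition orthonormal_basis ::
    "'i set \<Rightarrow> ('i \<Rightarrow> 'a::complex_hilbert_space) \<Rightarrow> 'a set \<Rightarrow> bool" where
  "orthonormal_basis I b W \<longleftrightarrow>
     (\<forall>i\<in>I. \<forall>j\<in>I. cinner (b i) (b j) = (if i = j then 1 else 0)) \<and>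
     closure (cspan (b ` I)) = W"

text \<open>The adjoint is uniquely determined by the equation below; it exists for every bounded
  operator, and only such operators are of interest here.\<close>

definition adjoint_op ::
    "('a::complex_hilbert_space \<Rightarrow> 'a) \<Rightarrow> ('a \<Rightarrow> 'a)"  (\<open>_\<^sup>\<dagger>\<close> [1000] 1000) where
  "A\<^sup>\<dagger> = (THE B. \<forall>x y. cinner (A x) y = cinner x (B y))"

lemma cinner_right_eqI:
  assumes "\<And>x. cinner x y = cinner x (z :: 'a::complex_hilbert_space)"
  shows "y = z"
proof -
  have "cinner (y - z) z + cinner (y - z) (y - z) = cinner (y - z) y"
    using cinner_add_left[of z "y - z" "y - z"] cinner_commute[of "y - z"]
    by (metis add.commute complex_cnj_add diff_add_cancel)
  then have "cinner (y - z) (y - z) = 0"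
    using assms[of "y - z"] by simp
  then have "norm (y - z) = 0"
    by (simp add: norm_eq_sqrt_cinner)
  then show ?thesis by simp
qed

lemma adjoint_op_eqI:
  assumes "\<And>x y. cinner (A x) y = cinner x (B y)"
  shows "A\<^sup>\<dagger> = B"
  unfolding adjoint_op_def
proof (rule the_equality)
  show "\<forall>x y. cinner (A x) y = cinner x (B y)"
    using assms by blast
next
  fix C assume "\<forall>x y. cinner (A x) y = cinner x (C y)"
  then show "C = B"
    using assms by (metis cinner_right_eqI ext)
qed

definition rank_one ::
    "'a::complex_hilbert_space \<Rightarrow> 'a \<Rightarrow> 'a \<Rightarrow> 'a"  (infix \<open>\<otimes>\<^sub>1\<close> 70) where
  "u \<otimes>\<^sub>1 v = (\<lambda>f. cinner f v *\<^sub>C u)"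

definition isometric :: "('a::complex_hilbert_space \<Rightarrow> 'a) \<Rightarrow> bool" where
  "isometric A \<longleftrightarrow> (\<forall>x. norm (A x) = norm x)"

definition quasinormal :: "('a::complex_hilbert_space \<Rightarrow> 'a) \<Rightarrow> bool" where
  "quasinormal A \<longleftrightarrow> A \<circ> (A\<^sup>\<dagger> \<circ> A) = (A\<^sup>\<dagger> \<circ> A) \<circ> A"

definition eigenvector ::
    "('a::complex_hilbert_space \<Rightarrow> 'a) \<Rightarrow> 'a \<Rightarrow> bool" where
  "eigenvector A x \<longleftrightarrow> x \<noteq> 0 \<and> (\<exists>c. A x = c *\<^sub>C x)"

text \<open>Dependence of the pair \<open>x, y\<close> as a family, so that \<open>x, x\<close> is dependent; the library's
  \<^const>\<open>module.dependent\<close> speaks about the set \<open>{x, y}\<close> instead.\<close>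

definition lin_dependent_pair :: "'a::complex_hilbert_space \<Rightarrow> 'a \<Rightarrow> bool" where
  "lin_dependent_pair x y \<longleftrightarrow>
     (\<exists>a b. (a \<noteq> 0 \<or> b \<noteq> 0) \<and> a *\<^sub>C x + b *\<^sub>C y = 0)"

definition orth_complement :: "'a::complex_hilbert_space set \<Rightarrow> 'a set" where
  "orth_complement M = {x. \<forall>y\<in>M. cinner x y = 0}"

definition orth_difference ::
    "'a::complex_hilbert_space set \<Rightarrow> 'a set \<Rightarrow> 'a set"  (infixl \<open>\<ominus>\<close> 65) where
  "K \<ominus> M = K \<inter> orth_complement M"

definition defect_kernel :: "('a::complex_hilbert_space \<Rightarrow> 'a) \<Rightarrow> 'a set" where
  "defect_kernel A = {x. x - A\<^sup>\<dagger> (A x) = 0}"  \<comment> \<open>the kernel of \<open>I - A\<^sup>*A\<close>\<close>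

end

theory Submission
  imports Defs
begin

text \<open>If \<open>S\<^sup>* u = \<alpha> v\<close>, then \<open>T\<^sup>* T = I + \<gamma> v \<otimes> v\<close> with \<open>\<gamma> = 2 Re \<alpha> + \<parallel>u\<parallel>\<^sup>2\<close>, and \<open>\<gamma> \<noteq> 0\<close> because \<open>T\<close>
  is not isometric. So \<open>K = ker (I - T\<^sup>* T)\<close> is the orthogonal complement of \<open>v\<close>, and \<open>T\<close> is
  quasinormal iff it commutes with \<open>v \<otimes> v\<close>, i.e. iff \<open>v\<close> is an eigenvector of \<open>S\<^sup>*\<close> and \<open>T v\<close> is
  orthogonal to \<open>K\<close>. In that case \<open>S K \<subseteq> K\<close>, and \<open>T v\<close> is automatically orthogonal to \<open>S K\<close> since
  \<open>S\<^sup>* T v\<close> is a multiple of \<open>v\<close>; only \<open>K \<ominus> S K\<close> remains. Splitting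
  \<open>u = (\<Sum>n<k. \<langle>u, e\<^sub>n\<rangle> e\<^sub>n) + S S\<^sup>* u\<close> in \<open>T v = S v + \<parallel>v\<parallel>\<^sup>2 u\<close> shows that the displayed expression is
  \<open>\<langle>T v, g\<^sub>i\<rangle>\<close>.\<close>

interpretation complex_vs: vector_space "scaleC :: complex \<Rightarrow> 'a \<Rightarrow> 'a::complex_hilbert_space"
  by (rule vector_space_scaleC)

section \<open>Complex Hilbert spaces\<close>

lemma cinner_add_right: "cinner x (y + z) = cinner x y + cinner x (z :: 'a::complex_hilbert_space)"
  by (metis cinner_add_left cinner_commute complex_cnj_add)

lemma cinner_scaleC_right: "cinner x (c *\<^sub>C y) = cnj c * cinner x (y :: 'a::complex_hilbert_space)"
  by (metis cinner_commute cinner_scaleC_left complex_cnj_mult)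

lemma cinner_self: "cinner x x = complex_of_real ((norm (x :: 'a::complex_hilbert_space))\<^sup>2)"
proof -
  have "Im (cinner x x) = Im (cnj (cinner x x))"
    using cinner_commute[of x x] by (rule arg_cong)
  then have "Im (cinner x x) = 0"
    by simp
  \<comment> \<open>The real \<open>sqrt\<close> is odd, so its nonnegative value forces a
    nonnegative argument.\<close>
  moreover have "0 \<le> Re (cinner x x)"
    using norm_ge_zero[of x] unfolding norm_eq_sqrt_cinner by simp
  ultimately show ?thesis
    by (simp add: complex_eq_iff norm_eq_sqrt_cinner)
qed

text \<open>Cauchy-Schwarz: with this \<open>a\<close>, \<open>x + a *\<^sub>C y\<close> is the
  component of \<open>x\<close> orthogonal to \<open>y\<close>, and its squared norm is
  nonnegative.\<close>

lemma norm_cinner_le: "norm (cinner x y) \<le> norm x * norm (y :: 'a::complex_hilbert_space)"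
proof (cases "y = 0")
  case True
  then show ?thesis
    using cinner_scaleC_right[of x 0 y] by simp
next
  case False
  define a where "a = - (cinner x y / complex_of_real ((norm y)\<^sup>2))"
  have "complex_of_real ((norm (x + a *\<^sub>C y))\<^sup>2)
      = cinner x x + cnj a * cinner x y + a * cnj (cinner x y) + a * cnj a * cinner y y"
    unfolding cinner_self[symmetric]
    by (simp add: cinner_add_left cinner_add_right cinner_scaleC_left cinner_scaleC_right
        cinner_commute[of y x] algebra_simps)
  also have "\<dots> = cinner x x - cinner x y * cnj (cinner x y) / complex_of_real ((norm y)\<^sup>2)"
    using False by (simp add: a_def cinner_self[of y] field_simps power2_eq_square)
  also have "\<dots> = complex_of_real ((norm x)\<^sup>2 - (norm (cinner x y))\<^sup>2 / (norm y)\<^sup>2)"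
    by (simp add: cinner_self flip: complex_norm_square)
  finally have "(norm x)\<^sup>2 - (norm (cinner x y))\<^sup>2 / (norm y)\<^sup>2 = (norm (x + a *\<^sub>C y))\<^sup>2"
    using of_real_eq_iff by metis
  then have "0 \<le> (norm x)\<^sup>2 - (norm (cinner x y))\<^sup>2 / (norm y)\<^sup>2"
    by simp
  then have "(norm (cinner x y))\<^sup>2 \<le> (norm x * norm y)\<^sup>2"
    using False by (simp add: field_simps power_mult_distrib)
  then show ?thesis
    by (rule power2_le_imp_le) simp
qed

text \<open>Opens the library's continuity and limit rules for bilinear maps to the inner
  product.\<close>

lemma bounded_bilinear_cinner:
  "bounded_bilinear (cinner :: 'a \<Rightarrow> 'a::complex_hilbert_space \<Rightarrow> complex)"
proof
  show "\<exists>K. \<forall>a b. norm (cinner a b) \<le> norm a * norm (b::'a) * K"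
    by (rule exI[of _ 1]) (simp add: norm_cinner_le)
qed (simp_all add: cinner_add_left cinner_add_right scaleR_scaleC cinner_scaleC_left
    cinner_scaleC_right scaleR_conv_of_real)

interpretation cinner: bounded_bilinear "cinner :: 'a \<Rightarrow> 'a::complex_hilbert_space \<Rightarrow> complex"
  by (rule bounded_bilinear_cinner)

lemmas cinner_simps =
  cinner_add_left cinner_add_right cinner_scaleC_left cinner_scaleC_right
  cinner.diff_left cinner.diff_right cinner.sum_left cinner.sum_right

section \<open>Orthogonality, spans and linear independence\<close>

lemma cinner_self_eq_0_iff: "cinner x x = 0 \<longleftrightarrow> x = (0 :: 'a::complex_hilbert_space)"
  by (simp add: cinner_self)

lemma cinner_eq_0_commute: "cinner x y = 0 \<longleftrightarrow> cinner y (x :: 'a::complex_hilbert_space) = 0"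
  by (metis cinner_commute complex_cnj_zero)

lemma orth_closure_cspan:
  fixes B :: "'a::complex_hilbert_space set"
  assumes "\<And>b. b \<in> B \<Longrightarrow> cinner z b = 0" and "x \<in> closure (cspan B)"
  shows "cinner z x = 0"
proof -
  have "cinner z y = 0" if "y \<in> cspan B" for y
    using that
    by (induction rule: complex_vs.span_induct_alt)
      (simp_all add: cinner_simps cinner.zero_right assms(1))
  then have "cspan B \<subseteq> {x. cinner z x = 0}"
    by blast
  moreover have "closed {x. cinner z x = 0}"
    by (intro closed_Collect_eq continuous_intros cinner.continuous_on)
  ultimately have "closure (cspan B) \<subseteq> {x. cinner z x = 0}"
    by (rule closure_minimal)
  with assms(2) show ?thesis
    by blast
qed

text \<open>The component \<open>r\<close> of \<open>y\<close> orthogonal to \<open>v\<close> is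
  orthogonal to \<open>y\<close> by hypothesis, hence to \<open>y - c *\<^sub>C v\<close>, which is
  \<open>r\<close> itself; so it vanishes.\<close>

lemma scaleC_if_orth_complement_subset:
  fixes v y :: "'a::complex_hilbert_space"
  assumes "v \<noteq> 0" and orth: "\<And>x. cinner x v = 0 \<Longrightarrow> cinner y x = 0"
  shows "\<exists>c. y = c *\<^sub>C v"
proof -
  define c where "c = cinner y v / cinner v v"
  define r where "r = y - c *\<^sub>C v"
  have rv: "cinner r v = 0"
    using assms(1) by (simp add: r_def c_def cinner_simps cinner_self_eq_0_iff)
  then have "cinner y r = 0"
    by (rule orth)
  moreover have "cinner v r = 0"
    using rv cinner_eq_0_commute by blast
  ultimately have "cinner (y - c *\<^sub>C v) r = 0"
    by (simp add: cinner_simps)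
  then have "y = c *\<^sub>C v"
    unfolding r_def cinner_self_eq_0_iff by simp
  then show ?thesis ..
qed

lemma lin_dependent_pair_scaleC:
  fixes x y :: "'a::complex_hilbert_space"
  assumes "lin_dependent_pair x y" and "x \<noteq> 0"
  shows "\<exists>c. y = c *\<^sub>C x"
proof -
  obtain a b where ab: "a \<noteq> 0 \<or> b \<noteq> 0" "a *\<^sub>C x + b *\<^sub>C y = 0"
    using assms(1) by (auto simp: lin_dependent_pair_def)
  have "b \<noteq> 0"
    using ab assms(2) by auto
  have "b *\<^sub>C y = (- a) *\<^sub>C x"
    using ab(2) by (simp add: add_eq_0_iff)
  then have "inverse b *\<^sub>C b *\<^sub>C y = inverse b *\<^sub>C (- a) *\<^sub>C x"
    by (rule arg_cong)
  then have "y = (inverse b * - a) *\<^sub>C x"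
    using \<open>b \<noteq> 0\<close> by (simp add: scaleC_scaleC scaleC_one)
  then show ?thesis ..
qed

text \<open>Nonzero pairwise orthogonal vectors are independent, since one in the span of the others
  would be orthogonal to itself. The exchange bound then applies.\<close>

lemma orthogonal_card_le:
  fixes X B :: "'a::complex_hilbert_space set"
  assumes "finite B" and "X \<subseteq> cspan B" and "0 \<notin> X"
    and orth: "\<And>x y. x \<in> X \<Longrightarrow> y \<in> X \<Longrightarrow> x \<noteq> y \<Longrightarrow> cinner x y = 0"
  shows "card X \<le> card B"
proof -
  have "\<not> complex_vs.dependent X"
  proof
    assume "complex_vs.dependent X"
    then obtain x where x: "x \<in> X" "x \<in> cspan (X - {x})"
      unfolding complex_vs.dependent_def by blast
    have "x \<in> closure (cspan (X - {x}))"
      using x(2) closure_subset by blast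
    then have "cinner x x = 0"
      by (rule orth_closure_cspan[rotated]) (use x(1) orth in auto)
    with x(1) assms(3) show False
      by (simp add: cinner_self_eq_0_iff)
  qed
  then show ?thesis
    using complex_vs.independent_span_bound[OF assms(1) _ assms(2)] by blast
qed

section \<open>The shift\<close>

locale shift =
  fixes e :: "nat \<Rightarrow> 'a::complex_hilbert_space" and S :: "'a \<Rightarrow> 'a" and k :: nat
  assumes basis: "orthonormal_basis UNIV e UNIV"
    and bounded: "bounded_clinear S"
    and shift_basis: "S (e n) = e (n + k)"
begin

sublocale S: bounded_linear S
  using bounded by (simp add: bounded_clinear_def)

lemma S_scaleC: "S (c *\<^sub>C x) = c *\<^sub>C S x"
  using bounded by (simp add: bounded_clinear_def)

lemma cinner_basis: "cinner (e i) (e j) = (if i = j then 1 else 0)"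
  using basis by (simp add: orthonormal_basis_def)

lemma dense_basis: "closure (cspan (range e)) = UNIV"
  using basis by (simp add: orthonormal_basis_def)

lemma orth_basis_eq_0:
  assumes "\<And>n. cinner x (e n) = 0"
  shows "x = 0"
proof -
  have "cinner x x = 0"
    by (rule orth_closure_cspan[of "range e"]) (use assms dense_basis in auto)
  then show ?thesis
    by (simp add: cinner_self_eq_0_iff)
qed

text \<open>The set of agreement is closed and contains the dense span. Asking for an induction step
  instead of linearity lets this serve both slots of the inner product, the second being
  conjugate-linear.\<close>

lemma eq_everywhere_if_eq_basis:
  fixes f h :: "'a \<Rightarrow> complex"
  assumes "continuous_on UNIV f" and "continuous_on UNIV h" and "f 0 = h 0"
    and "\<And>c n y. f y = h y \<Longrightarrow> f (c *\<^sub>C e n + y) = h (c *\<^sub>C e n + y)"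
  shows "f x = h x"
proof -
  have "closed {x. f x = h x}"
    by (intro closed_Collect_eq assms(1,2))
  moreover have "cspan (range e) \<subseteq> {x. f x = h x}"
  proof
    fix y assume "y \<in> cspan (range e)"
    then show "y \<in> {x. f x = h x}"
      by (induction rule: complex_vs.span_induct_alt) (auto simp: assms(3,4))
  qed
  ultimately show ?thesis
    using closure_minimal dense_basis by blast
qed

text \<open>Orthonormality of the shifted basis extends by density one slot at a time: first the
  left one against a basis vector, then the right one.\<close>

lemma isometry_cinner: "cinner (S x) (S y) = cinner x y"
proof -
  note continuous = cinner.continuous_on S.continuous_on continuous_intros
  have basis_case: "cinner (S x) (S (e n)) = cinner x (e n)" for x n
  proof (rule eq_everywhere_if_eq_basis[of "\<lambda>x. cinner (S x) (S (e n))"])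
    show "cinner (S (c *\<^sub>C e j + y)) (S (e n)) = cinner (c *\<^sub>C e j + y) (e n)"
      if "cinner (S y) (S (e n)) = cinner y (e n)" for c j y
      using that by (simp add: S.add S_scaleC cinner_simps shift_basis cinner_basis)
  qed (intro continuous | simp add: S.zero cinner.zero_left)+
  show ?thesis
  proof (rule eq_everywhere_if_eq_basis[of "\<lambda>y. cinner (S x) (S y)"])
    show "cinner (S x) (S (c *\<^sub>C e n + y)) = cinner x (c *\<^sub>C e n + y)"
      if "cinner (S x) (S y) = cinner x y" for c n y
      using that by (simp add: S.add S_scaleC cinner_simps basis_case)
  qed (intro continuous | simp add: S.zero cinner.zero_right)+
qed

lemma norm_S: "norm (S x) = norm x"
  by (simp add: norm_eq_sqrt_cinner isometry_cinner)

lemma cinner_S_basis: "n < k \<Longrightarrow> cinner (S x) (e n) = 0"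
proof (rule eq_everywhere_if_eq_basis[of "\<lambda>x. cinner (S x) (e n)" "\<lambda>x. 0"])
  show "cinner (S (c *\<^sub>C e j + y)) (e n) = 0" if "cinner (S y) (e n) = 0" and "n < k" for c j y
    using that by (simp add: S.add S_scaleC cinner_simps shift_basis cinner_basis)
qed (intro cinner.continuous_on S.continuous_on continuous_intros
    | simp add: S.zero cinner.zero_left)+

text \<open>The vectors at which the adjoint can be evaluated form a closed subspace, closed because \<open>S\<close>
  is contractive, and they include the basis; this replaces the Riesz representation theorem.\<close>

lemma adjoint_exists: "\<exists>z. \<forall>x. cinner (S x) y = cinner x z"
proof -
  define D where "D = {y. \<exists>z. \<forall>x. cinner (S x) y = cinner x z}"
  have basis_case: "\<exists>z. \<forall>x. cinner (S x) (e n) = cinner x z" for n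
  proof (cases "n < k")
    case True
    then show ?thesis
      by (intro exI[of _ 0]) (simp add: cinner_S_basis cinner.zero_right)
  next
    case False
    then have "e n = S (e (n - k))"
      by (simp add: shift_basis)
    then show ?thesis
      by (intro exI[of _ "e (n - k)"]) (simp add: isometry_cinner)
  qed
  have "cspan (range e) \<subseteq> D"
  proof
    fix y assume "y \<in> cspan (range e)"
    then show "y \<in> D"
    proof (induction rule: complex_vs.span_induct_alt)
      case base
      then show ?case
        unfolding D_def by (auto intro!: exI[of _ 0] simp: cinner.zero_right)
    next
      case (step c b y)
      obtain z where z: "\<And>x. cinner (S x) b = cinner x z"
        using basis_case step by blast
      obtain z' where z': "\<And>x. cinner (S x) y = cinner x z'"
        using step unfolding D_def by blast
      show ?case
        unfolding D_def by (auto intro!: exI[of _ "c *\<^sub>C z + z'"] simp: cinner_simps z z')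
    qed
  qed
  moreover have "closed D"
    unfolding closed_sequential_limits
  proof (intro allI impI; elim conjE)
    fix ys y assume "\<forall>n. ys n \<in> D" and lim: "ys \<longlonglongrightarrow> y"
    then have "\<forall>n. \<exists>z. \<forall>x. cinner (S x) (ys n) = cinner x z"
      by (simp add: D_def)
    then obtain zs where zs: "\<And>n x. cinner (S x) (ys n) = cinner x (zs n)"
      by (auto simp: choice_iff)
    have contr: "norm (zs i - zs j) \<le> norm (ys i - ys j)" for i j
    proof -
      \<comment> \<open>Testing the representation at the difference itself bounds its squared norm;
        since \<open>S\<close> preserves norms, one factor cancels.\<close>
      let ?z = "zs i - zs j"
      have "complex_of_real ((norm ?z)\<^sup>2) = cinner (S ?z) (ys i - ys j)"
        unfolding cinner_self[symmetric] by (simp add: cinner.diff_right zs)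
      then have "norm (complex_of_real ((norm ?z)\<^sup>2)) \<le> norm (S ?z) * norm (ys i - ys j)"
        using norm_cinner_le[of "S ?z" "ys i - ys j"] by (simp only:)
      then have "norm ?z * norm ?z \<le> norm ?z * norm (ys i - ys j)"
        unfolding norm_S norm_of_real by (simp add: power2_eq_square)
      then show ?thesis
        by (cases "norm ?z = 0") (simp_all add: mult_le_cancel_left)
    qed
    have "Cauchy ys"
      using lim by (rule LIMSEQ_imp_Cauchy)
    then have "Cauchy zs"
      unfolding Cauchy_iff by (meson contr le_less_trans)
    then obtain z where z: "zs \<longlonglongrightarrow> z"
      using Cauchy_convergent convergentD by blast
    have "cinner (S x) y = cinner x z" for x
    proof (rule LIMSEQ_unique)
      show "(\<lambda>n. cinner x (zs n)) \<longlonglongrightarrow> cinner x z"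
        by (intro cinner.tendsto tendsto_const z)
      show "(\<lambda>n. cinner x (zs n)) \<longlonglongrightarrow> cinner (S x) y"
        unfolding zs[symmetric] by (intro cinner.tendsto tendsto_const lim)
    qed
    then show "y \<in> D"
      unfolding D_def by blast
  qed
  ultimately have "D = UNIV"
    using closure_minimal dense_basis by blast
  then show ?thesis
    unfolding D_def by blast
qed

text \<open>Choice collects the representing vectors into a function, and uniqueness identifies it
  with \<open>S\<^sup>\<dagger>\<close>.\<close>

lemma cinner_adjoint: "cinner (S x) y = cinner x (S\<^sup>\<dagger> y)"
proof -
  have "\<forall>y. \<exists>z. \<forall>x. cinner (S x) y = cinner x z"
    using adjoint_exists by blast
  then obtain B where "\<And>x y. cinner (S x) y = cinner x (B y)"
    by (auto simp: choice_iff)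
  then show ?thesis
    using adjoint_op_eqI[of S B] by simp
qed

lemma cinner_adjoint_left: "cinner (S\<^sup>\<dagger> y) x = cinner y (S x)"
  by (metis cinner_adjoint cinner_commute)

lemma adjoint_S [simp]: "S\<^sup>\<dagger> (S x) = x"
  by (rule cinner_right_eqI) (simp flip: cinner_adjoint add: isometry_cinner)

lemma adjoint_add: "S\<^sup>\<dagger> (x + y) = S\<^sup>\<dagger> x + S\<^sup>\<dagger> y"
  by (rule cinner_right_eqI) (simp add: cinner_add_right flip: cinner_adjoint)

lemma adjoint_scaleC: "S\<^sup>\<dagger> (c *\<^sub>C x) = c *\<^sub>C S\<^sup>\<dagger> x"
  by (rule cinner_right_eqI) (simp add: cinner_scaleC_right flip: cinner_adjoint)

text \<open>The difference of the two sides is orthogonal to every \<open>e j\<close>: for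
  \<open>j < k\<close> the range of \<open>S\<close> contributes nothing, and otherwise
  \<open>e j\<close> lies in that range and the sum contributes nothing.\<close>

lemma wold_decomposition: "x = (\<Sum>n<k. cinner x (e n) *\<^sub>C e n) + S (S\<^sup>\<dagger> x)"
proof -
  define y where "y = x - S (S\<^sup>\<dagger> x) - (\<Sum>n<k. cinner x (e n) *\<^sub>C e n)"
  have "y = 0"
  proof (rule orth_basis_eq_0)
    fix j
    show "cinner y (e j) = 0"
    proof (cases "j < k")
      case True
      then show ?thesis
        by (simp add: y_def cinner_simps cinner_S_basis cinner_basis if_distrib cong: if_cong)
    next
      case False
      then have "e j = S (e (j - k))"
        by (simp add: shift_basis)
      then have "cinner (S (S\<^sup>\<dagger> x)) (e j) = cinner x (e j)"
        by (simp add: isometry_cinner cinner_adjoint_left)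
      moreover have "cinner (e n) (e j) = 0" if "n < k" for n
        using that False by (simp add: cinner_basis)
      ultimately show ?thesis
        by (simp add: y_def cinner_simps)
    qed
  qed
  then show ?thesis
    by (simp add: y_def algebra_simps)
qed

end

section \<open>The rank-one perturbation\<close>

text \<open>The scalar \<open>\<alpha>\<close> encodes the linear dependence of \<open>v\<close> and
  \<open>S\<^sup>\<dagger> u\<close> for nonzero \<open>v\<close>.\<close>

locale perturbed_shift = shift e S k
  for e :: "nat \<Rightarrow> 'a::complex_hilbert_space" and S :: "'a \<Rightarrow> 'a" and k :: nat +
  fixes u v :: 'a and \<alpha> :: complex and T :: "'a \<Rightarrow> 'a"
  assumes v_nonzero: "v \<noteq> 0"
    and T_def: "T = (\<lambda>x. S x + (u \<otimes>\<^sub>1 v) x)"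
    and adjoint_u: "S\<^sup>\<dagger> u = \<alpha> *\<^sub>C v"
    and not_isometric: "\<not> isometric T"
begin

section \<open>The adjoint of \<open>T\<close>, and quasinormality as commutation with
  \<open>v \<otimes>\<^sub>1 v\<close>\<close>

lemma T_apply: "T x = S x + cinner x v *\<^sub>C u"
  by (simp add: T_def rank_one_def)

lemma T_scaleC: "T (c *\<^sub>C x) = c *\<^sub>C T x"
  by (simp add: T_apply S_scaleC cinner_simps scaleC_add_right scaleC_scaleC)

lemma T_add: "T (x + y) = T x + T y"
  by (simp add: T_apply S.add cinner_simps scaleC_add_left)

text \<open>The adjoint of \<open>u \<otimes>\<^sub>1 v\<close> is
  \<open>v \<otimes>\<^sub>1 u\<close>.\<close>

lemma adjoint_T: "T\<^sup>\<dagger> = (\<lambda>y. S\<^sup>\<dagger> y + cinner y u *\<^sub>C v)"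
proof (rule adjoint_op_eqI)
  fix x y
  show "cinner (T x) y = cinner x (S\<^sup>\<dagger> y + cinner y u *\<^sub>C v)"
    by (simp add: T_apply cinner_simps cinner_adjoint mult.commute flip: cinner_commute)
qed

lemma cinner_adjoint_T: "cinner (T x) y = cinner x (T\<^sup>\<dagger> y)"
  by (simp add: adjoint_T T_apply cinner_simps cinner_adjoint mult.commute flip: cinner_commute)

definition \<gamma> :: complex where
  "\<gamma> = \<alpha> + cnj \<alpha> + cinner u u"

text \<open>Besides \<open>S\<^sup>\<dagger> (S x) = x\<close> there are two cross terms, which
  \<open>S\<^sup>\<dagger> u = \<alpha> *\<^sub>C v\<close> turns into multiples of \<open>v\<close>
  with coefficients \<open>\<alpha>\<close> and \<open>cnj \<alpha>\<close>, and the term with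
  \<open>cinner u u\<close>.\<close>

lemma adjoint_T_T: "T\<^sup>\<dagger> (T x) = x + (\<gamma> * cinner x v) *\<^sub>C v"
proof -
  have "T\<^sup>\<dagger> (T x) = x + (cinner x v * \<alpha> + (cnj \<alpha> * cinner x v + cinner x v * cinner u u)) *\<^sub>C v"
    by (simp add: T_apply adjoint_T adjoint_add adjoint_scaleC adjoint_u cinner_simps
        cinner_adjoint scaleC_scaleC scaleC_add_left add.assoc)
  then show ?thesis
    by (simp add: \<gamma>_def algebra_simps)
qed

lemma \<gamma>_nonzero: "\<gamma> \<noteq> 0"
proof
  assume "\<gamma> = 0"
  then have "cinner (T x) (T x) = cinner x x" for x
    by (simp add: cinner_adjoint_T adjoint_T_T)
  then have "isometric T"
    by (simp add: isometric_def norm_eq_sqrt_cinner)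
  with not_isometric show False ..
qed

lemma defect_kernel_eq: "defect_kernel T = {x. cinner x v = 0}"
  using \<gamma>_nonzero v_nonzero by (auto simp: defect_kernel_def adjoint_T_T)

text \<open>The identity part of \<open>T\<^sup>\<dagger> \<circ> T\<close> commutes with
  \<open>T\<close> and the nonzero factor \<open>\<gamma>\<close> cancels; what remains is
  \<open>T\<close> commuting with \<open>v \<otimes>\<^sub>1 v\<close>, evaluated at
  \<open>x\<close>.\<close>

lemma quasinormal_iff_commute:
  "quasinormal T \<longleftrightarrow> (\<forall>x. cinner x v *\<^sub>C T v = cinner (T x) v *\<^sub>C v)"
proof -
  have "T (T\<^sup>\<dagger> (T x)) = T\<^sup>\<dagger> (T (T x)) \<longleftrightarrow> cinner x v *\<^sub>C T v = cinner (T x) v *\<^sub>C v" for x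
  proof -
    have "T (T\<^sup>\<dagger> (T x)) = T\<^sup>\<dagger> (T (T x)) \<longleftrightarrow>
        \<gamma> *\<^sub>C (cinner x v *\<^sub>C T v) = \<gamma> *\<^sub>C (cinner (T x) v *\<^sub>C v)"
      by (simp add: adjoint_T_T T_add T_scaleC scaleC_scaleC del: complex_vs.scale_cancel_right)
    then show ?thesis
      using \<gamma>_nonzero by (simp only: complex_vs.scale_cancel_left) simp
  qed
  then show ?thesis
    by (simp add: quasinormal_def fun_eq_iff)
qed

text \<open>A line is invariant under the adjoint iff its orthogonal complement is invariant under
  \<open>S\<close>; here that complement is \<open>defect_kernel T\<close>.\<close>

lemma eigenvector_adjoint_iff:
  "eigenvector (S\<^sup>\<dagger>) v \<longleftrightarrow> (\<forall>x. cinner x v = 0 \<longrightarrow> cinner (S x) v = 0)"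
proof
  assume "eigenvector (S\<^sup>\<dagger>) v"
  then show "\<forall>x. cinner x v = 0 \<longrightarrow> cinner (S x) v = 0"
    by (auto simp: eigenvector_def cinner_adjoint cinner_simps)
next
  assume *: "\<forall>x. cinner x v = 0 \<longrightarrow> cinner (S x) v = 0"
  have "\<exists>c. S\<^sup>\<dagger> v = c *\<^sub>C v"
  proof (rule scaleC_if_orth_complement_subset[OF v_nonzero])
    fix x assume "cinner x v = 0"
    with * have "cinner (S x) v = 0"
      by blast
    then show "cinner (S\<^sup>\<dagger> v) x = 0"
      unfolding cinner_adjoint_left using cinner_eq_0_commute by blast
  qed
  with v_nonzero show "eigenvector (S\<^sup>\<dagger>) v"
    by (simp add: eigenvector_def)
qed

text \<open>At \<open>x\<close> orthogonal to \<open>v\<close>, where \<open>T x = S x\<close>,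
  commutation gives the eigenvector condition; at \<open>v\<close> it makes \<open>T v\<close> a
  multiple of \<open>v\<close>. Conversely, \<open>v\<close> is an eigenvector of both
  \<open>T\<close> and its adjoint.\<close>

lemma quasinormal_iff_orth_defect:
  "quasinormal T \<longleftrightarrow> eigenvector (S\<^sup>\<dagger>) v \<and> (\<forall>x. cinner x v = 0 \<longrightarrow> cinner (T v) x = 0)"
proof
  assume "quasinormal T"
  then have comm: "cinner x v *\<^sub>C T v = cinner (T x) v *\<^sub>C v" for x
    by (simp add: quasinormal_iff_commute)
  have "cinner (S x) v = 0" if "cinner x v = 0" for x
    using comm[of x] that v_nonzero by (simp add: T_apply)
  moreover have "cinner (T v) x = 0" if x: "cinner x v = 0" for x
  proof -
    have "cinner v v * cinner (T v) x = cinner (T v) v * cinner v x"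
      using arg_cong[OF comm[of v], of "\<lambda>y. cinner y x"] by (simp only: cinner_simps)
    moreover have "cinner v x = 0"
      using x cinner_eq_0_commute by blast
    ultimately show ?thesis
      using v_nonzero by (simp add: cinner_self_eq_0_iff)
  qed
  ultimately show "eigenvector (S\<^sup>\<dagger>) v \<and> (\<forall>x. cinner x v = 0 \<longrightarrow> cinner (T v) x = 0)"
    by (simp add: eigenvector_adjoint_iff)
next
  assume *: "eigenvector (S\<^sup>\<dagger>) v \<and> (\<forall>x. cinner x v = 0 \<longrightarrow> cinner (T v) x = 0)"
  then obtain \<beta> where \<beta>: "S\<^sup>\<dagger> v = \<beta> *\<^sub>C v"
    by (auto simp: eigenvector_def)
  obtain \<mu> where \<mu>: "T v = \<mu> *\<^sub>C v"
    using scaleC_if_orth_complement_subset[OF v_nonzero, of "T v"] * by blast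
  \<comment> \<open>The eigenvalue of \<open>T\<^sup>\<dagger>\<close> at \<open>v\<close> is
    \<open>\<beta> + cinner v u\<close>; moving it out of the second slot conjugates it.\<close>
  define \<nu> where "\<nu> = cnj (\<beta> + cinner v u)"
  have \<nu>: "cinner (T x) v = \<nu> * cinner x v" for x
    by (simp add: cinner_adjoint_T adjoint_T \<beta> \<nu>_def cinner_scaleC_right flip: scaleC_add_left)
  have "\<mu> = \<nu>"
    using \<nu>[of v] v_nonzero by (simp add: \<mu> cinner_simps cinner_self_eq_0_iff)
  then show "quasinormal T"
    by (simp add: quasinormal_iff_commute \<mu> \<nu> scaleC_scaleC cinner_simps mult.commute)
qed

section \<open>The displayed condition and the wandering subspace\<close>

lemma T_v_eq:
  "T v = (1 + cinner (S\<^sup>\<dagger> u) v) *\<^sub>C S v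
     + complex_of_real ((norm v)\<^sup>2) *\<^sub>C (\<Sum>n<k. cinner u (e n) *\<^sub>C e n)"
proof -
  have "T v = S v + cinner v v *\<^sub>C ((\<Sum>n<k. cinner u (e n) *\<^sub>C e n) + S (S\<^sup>\<dagger> u))"
    by (simp only: T_apply flip: wold_decomposition)
  also have "\<dots> = (1 + \<alpha> * cinner v v) *\<^sub>C S v + cinner v v *\<^sub>C (\<Sum>n<k. cinner u (e n) *\<^sub>C e n)"
    by (simp add: adjoint_u S_scaleC scaleC_add_left scaleC_add_right scaleC_scaleC scaleC_one
        mult.commute)
  finally show ?thesis
    by (simp add: adjoint_u cinner_simps cinner_self)
qed

lemma cinner_T_v:
  "cinner (T v) x = (1 + cinner (S\<^sup>\<dagger> u) v) * cinner (S v) x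
     + complex_of_real ((norm v)\<^sup>2) * (\<Sum>n<k. cinner u (e n) * cinner (e n) x)"
  by (simp only: T_v_eq cinner_simps)

lemma T_v_orth_S_defect: "cinner x v = 0 \<Longrightarrow> cinner (T v) (S x) = 0"
proof -
  assume "cinner x v = 0"
  then have "cinner v x = 0"
    using cinner_eq_0_commute by blast
  moreover have "S\<^sup>\<dagger> (T v) = (1 + cinner v v * \<alpha>) *\<^sub>C v"
    by (simp add: T_apply adjoint_add adjoint_scaleC adjoint_u scaleC_scaleC scaleC_add_left scaleC_one)
  ultimately show ?thesis
    by (simp add: cinner_scaleC_left flip: cinner_adjoint_left)
qed

text \<open>Here \<open>y\<close> is the projection of \<open>S\<^sup>\<dagger> x\<close> onto the
  complement of \<open>v\<close>, and \<open>r = x - S y\<close>. As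
  \<open>S\<^sup>\<dagger> x - y\<close> is a multiple of \<open>v\<close>, \<open>r\<close> is
  orthogonal to the image of the kernel; the eigenvector condition keeps \<open>S y\<close>, and so
  \<open>r\<close>, in the kernel.\<close>

lemma defect_decomposition:
  assumes "eigenvector (S\<^sup>\<dagger>) v" and x: "cinner x v = 0"
  obtains r y where "x = r + S y" and "cinner y v = 0"
    and "r \<in> defect_kernel T \<ominus> S ` defect_kernel T"
proof -
  define c where "c = cinner (S\<^sup>\<dagger> x) v / cinner v v"
  define y where "y = S\<^sup>\<dagger> x - c *\<^sub>C v"
  have y: "cinner y v = 0"
    using v_nonzero by (simp add: y_def c_def cinner_simps cinner_self_eq_0_iff)
  then have "cinner (S y) v = 0"
    using assms(1) by (simp add: eigenvector_adjoint_iff)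
  then have "x - S y \<in> defect_kernel T"
    by (simp add: defect_kernel_eq cinner_simps x)
  moreover have "cinner (x - S y) (S f) = 0" if "cinner f v = 0" for f
  proof -
    have "cinner v f = 0"
      using that cinner_eq_0_commute by blast
    then show ?thesis
      by (simp add: cinner_simps isometry_cinner y_def cinner_adjoint_left)
  qed
  ultimately have "x - S y \<in> defect_kernel T \<ominus> S ` defect_kernel T"
    by (auto simp: orth_difference_def orth_complement_def defect_kernel_eq)
  with y show thesis
    by (intro that[of "x - S y" y]) simp_all
qed

text \<open>Under the eigenvector condition the kernel splits into the wandering subspace and its
  image under \<open>S\<close>. \<open>T v\<close> is orthogonal to the image anyway, and
  orthogonality to \<open>G\<close> passes to the closed span.\<close>

lemma quasinormal_iff_orth_wandering:
  assumes G: "closure (cspan G) = defect_kernel T \<ominus> S ` defect_kernel T"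
  shows "quasinormal T \<longleftrightarrow> eigenvector (S\<^sup>\<dagger>) v \<and> (\<forall>x\<in>G. cinner (T v) x = 0)"
proof -
  have "(\<forall>x. cinner x v = 0 \<longrightarrow> cinner (T v) x = 0) \<longleftrightarrow> (\<forall>x\<in>G. cinner (T v) x = 0)"
    if ev: "eigenvector (S\<^sup>\<dagger>) v"
  proof
    assume orth: "\<forall>x. cinner x v = 0 \<longrightarrow> cinner (T v) x = 0"
    have "G \<subseteq> defect_kernel T"
      using G closure_subset[of "cspan G"] complex_vs.span_superset[of G]
      by (auto simp: orth_difference_def)
    with orth show "\<forall>x\<in>G. cinner (T v) x = 0"
      by (auto simp: defect_kernel_eq)
  next
    assume orth: "\<forall>x\<in>G. cinner (T v) x = 0"
    show "\<forall>x. cinner x v = 0 \<longrightarrow> cinner (T v) x = 0"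
    proof (intro allI impI)
      fix x assume "cinner x v = 0"
      with ev obtain r y where *: "x = r + S y" "cinner y v = 0" "r \<in> closure (cspan G)"
        unfolding G by (rule defect_decomposition)
      have "cinner (T v) r = 0"
        using orth_closure_cspan[of G "T v" r] orth *(3) by blast
      then show "cinner (T v) x = 0"
        by (simp add: *(1) cinner_add_right T_v_orth_S_defect *(2))
    qed
  qed
  then show ?thesis
    unfolding quasinormal_iff_orth_defect by blast
qed

text \<open>The wandering subspace lies in the span of the \<open>k\<close> first basis vectors and \<open>S v\<close>. The
  projection of \<open>v\<close> to this span is nonzero and orthogonal to the wandering subspace, which
  brings the dimension down from \<open>k + 1\<close> to \<open>k\<close>.\<close>

lemma wandering_card_le:
  assumes inv: "S ` defect_kernel T \<subseteq> defect_kernel T"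
    and G: "G \<subseteq> defect_kernel T \<ominus> S ` defect_kernel T" "finite G" "0 \<notin> G"
    and orth: "\<And>x y. x \<in> G \<Longrightarrow> y \<in> G \<Longrightarrow> x \<noteq> y \<Longrightarrow> cinner x y = 0"
  shows "card G \<le> k"
proof -
  define B where "B = insert (S v) (e ` {..<k})"
  \<comment> \<open>\<open>S v\<close> is orthogonal to the first \<open>k\<close> basis vectors and
    \<open>cinner (S v) (S v) = cinner v v\<close>, so this coefficient makes \<open>w\<close> the
    projection of \<open>v\<close> onto the span of \<open>B\<close>.\<close>
  define d where "d = cinner v (S v) / cinner v v"
  define w where "w = (\<Sum>n<k. cinner v (e n) *\<^sub>C e n) + d *\<^sub>C S v"
  have B_span: "(\<Sum>n<k. c n *\<^sub>C e n) + a *\<^sub>C S v \<in> cspan B" for c a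
    by (intro complex_vs.span_add complex_vs.span_sum complex_vs.span_scale complex_vs.span_base)
      (auto simp: B_def)
  then have w_span: "w \<in> cspan B"
    by (simp only: w_def)
  have G_span: "x \<in> cspan B" if "x \<in> G" for x
  proof -
    \<comment> \<open>Orthogonality of \<open>x\<close> to the image of the kernel makes
      \<open>S\<^sup>\<dagger> x\<close> orthogonal to the kernel, that is, to the complement of
      \<open>v\<close>.\<close>
    have "\<exists>c. S\<^sup>\<dagger> x = c *\<^sub>C v"
    proof (rule scaleC_if_orth_complement_subset[OF v_nonzero])
      fix f assume "cinner f v = 0"
      then show "cinner (S\<^sup>\<dagger> x) f = 0"
        using that G(1)
        by (auto simp: orth_difference_def orth_complement_def defect_kernel_eq cinner_adjoint_left)
    qed
    then obtain c where "S\<^sup>\<dagger> x = c *\<^sub>C v" ..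
    then have "(\<Sum>n<k. cinner x (e n) *\<^sub>C e n) + c *\<^sub>C S v = x"
      using wold_decomposition[of x, symmetric] by (simp add: S_scaleC)
    then show ?thesis
      using B_span[of "\<lambda>n. cinner x (e n)" c] by simp
  qed
  have vw_orth: "cinner (v - w) b = 0" if "b \<in> B" for b
  proof (cases "b = S v")
    case True
    have "cinner (e n) (S v) = 0" if "n < k" for n
      using that cinner_S_basis cinner_eq_0_commute by blast
    then show ?thesis
      using True v_nonzero
      by (simp add: w_def d_def cinner_simps isometry_cinner cinner_self_eq_0_iff)
  next
    case False
    with that obtain n where "n < k" "b = e n"
      by (auto simp: B_def)
    then show ?thesis
      by (simp add: w_def cinner_simps cinner_S_basis cinner_basis if_distrib cong: if_cong)
  qed
  have w_orth: "cinner w x = 0" if "x \<in> G" for x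
  proof -
    have "cinner x v = 0"
      using that G(1) by (auto simp: orth_difference_def defect_kernel_eq)
    then have "cinner v x = 0"
      using cinner_eq_0_commute by blast
    moreover have "cinner (v - w) x = 0"
      using orth_closure_cspan[OF vw_orth] G_span[OF that] closure_subset by blast
    ultimately show ?thesis
      by (simp add: cinner_simps)
  qed
  \<comment> \<open>Otherwise \<open>v\<close> is orthogonal to \<open>B\<close>, so it lies in the
    range of \<open>S\<close>, and the eigenvector condition gives
    \<open>v = \<beta> *\<^sub>C S v\<close>, contradicting orthogonality to
    \<open>S v\<close>.\<close>
  have "w \<noteq> 0"
  proof
    assume "w = 0"
    then have v_orth: "cinner v b = 0" if "b \<in> B" for b
      using vw_orth[OF that] by simp
    then have "cinner v (e n) = 0" if "n < k" for n
      using that by (simp add: B_def)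
    then have v: "S (S\<^sup>\<dagger> v) = v"
      using wold_decomposition[of v, symmetric] by simp
    have "eigenvector (S\<^sup>\<dagger>) v"
      using inv by (auto simp: eigenvector_adjoint_iff defect_kernel_eq)
    then obtain \<beta> where "S\<^sup>\<dagger> v = \<beta> *\<^sub>C v"
      by (auto simp: eigenvector_def)
    with v have "\<beta> *\<^sub>C S v = v"
      by (simp add: S_scaleC)
    then have "cinner v v = cinner v (\<beta> *\<^sub>C S v)"
      by simp
    also have "\<dots> = 0"
      using v_orth by (simp add: B_def cinner_scaleC_right)
    finally show False
      using v_nonzero by (simp add: cinner_self_eq_0_iff)
  qed
  then have "w \<notin> G"
    using w_orth[of w] by (auto simp: cinner_self_eq_0_iff)
  have "card (insert w G) \<le> card B"
  proof (rule orthogonal_card_le)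
    have "cinner x w = 0" if "x \<in> G" for x
      using w_orth[OF that] cinner_eq_0_commute by blast
    then show "cinner x y = 0" if "x \<in> insert w G" "y \<in> insert w G" "x \<noteq> y" for x y
      using that orth w_orth by auto
  qed (use G_span w_span \<open>w \<noteq> 0\<close> G(3) in \<open>auto simp: B_def\<close>)
  also have "card B \<le> Suc (card (e ` {..<k}))"
    by (simp add: B_def card_insert_if)
  also have "\<dots> \<le> Suc k"
    using card_image_le[of "{..<k}" e] by simp
  finally show ?thesis
    using \<open>w \<notin> G\<close> G(2) by simp
qed

end

theorem theorem3p3:
  fixes T S :: "'a::complex_hilbert_space \<Rightarrow> 'a"
    and e g :: "nat \<Rightarrow> 'a"
    and u v :: 'a
    and k m :: nat
  assumes "k \<ge> 1"
    and "bounded_clinear T"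
    and "\<not> isometric T"
    and "orthonormal_basis UNIV e UNIV"
    and "bounded_clinear S" and "\<And>n. S (e n) = e (n + k)"
    and "u \<noteq> 0" and "v \<noteq> 0"
    and "T = (\<lambda>x. S x + (u \<otimes>\<^sub>1 v) x)"
    and "lin_dependent_pair v (S\<^sup>\<dagger> u)"
    and "orthonormal_basis {1..m} g (defect_kernel T \<ominus> S ` defect_kernel T)"
  shows "(quasinormal T \<longleftrightarrow>
            eigenvector (S\<^sup>\<dagger>) v \<and>
            (\<forall>i\<in>{1..m}.
               (1 + cinner (S\<^sup>\<dagger> u) v) * cinner (S v) (g i)
               + complex_of_real ((norm v)\<^sup>2)
                 * (\<Sum>n=0..k-1. cinner u (e n) * cinner (e n) (g i)) = 0))
         \<and> (S ` defect_kernel T \<subseteq> defect_kernel T \<longrightarrow> m \<le> k)"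
proof -
  obtain \<alpha> where "S\<^sup>\<dagger> u = \<alpha> *\<^sub>C v"
    using lin_dependent_pair_scaleC assms(8,10) by blast
  then interpret perturbed_shift e S k u v \<alpha> T
    using assms by unfold_locales
  have g_orth: "cinner (g i) (g j) = (if i = j then 1 else 0)" if "i \<in> {1..m}" "j \<in> {1..m}" for i j
    using assms(11) that unfolding orthonormal_basis_def by blast
  have g_span: "closure (cspan (g ` {1..m})) = defect_kernel T \<ominus> S ` defect_kernel T"
    using assms(11) unfolding orthonormal_basis_def by blast
  \<comment> \<open>With \<open>k \<ge> 1\<close> the subtraction is not truncated; at
    \<open>k = 0\<close> the left side would be \<open>{0}\<close>.\<close>
  have "{0..k-1} = {..<k}"
    using assms(1) by auto
  then have "quasinormal T \<longleftrightarrow>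
            eigenvector (S\<^sup>\<dagger>) v \<and>
            (\<forall>i\<in>{1..m}.
               (1 + cinner (S\<^sup>\<dagger> u) v) * cinner (S v) (g i)
               + complex_of_real ((norm v)\<^sup>2)
                 * (\<Sum>n=0..k-1. cinner u (e n) * cinner (e n) (g i)) = 0)"
    unfolding quasinormal_iff_orth_wandering[OF g_span] cinner_T_v by simp
  moreover have "m \<le> k" if "S ` defect_kernel T \<subseteq> defect_kernel T"
  proof -
    \<comment> \<open>Distinct indices give distinct vectors, so \<open>m\<close> counts the set
      bounded by \<open>wandering_card_le\<close>.\<close>
    have "inj_on g {1..m}"
      by (rule inj_onI) (metis g_orth zero_neq_one)
    then have "m = card (g ` {1..m})"
      by (simp add: card_image)
    also have "\<dots> \<le> k"
    proof (rule wandering_card_le[OF that])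
      show "g ` {1..m} \<subseteq> defect_kernel T \<ominus> S ` defect_kernel T"
        unfolding g_span[symmetric]
        by (rule order_trans[OF complex_vs.span_superset closure_subset])
      show "0 \<notin> g ` {1..m}"
      proof
        assume "0 \<in> g ` {1..m}"
        then obtain i where "i \<in> {1..m}" "g i = 0"
          by auto
        with g_orth[of i i] show False
          by (simp add: cinner.zero_left)
      qed
      show "cinner x y = 0" if "x \<in> g ` {1..m}" "y \<in> g ` {1..m}" "x \<noteq> y" for x y
      proof -
        from that obtain i j where "x = g i" "y = g j" "i \<in> {1..m}" "j \<in> {1..m}"
          by blast
        with g_orth[of i j] \<open>x \<noteq> y\<close> show ?thesis
          by auto
      qed
    qed simp
    finally show ?thesis .
  qed
  ultimately show ?thesis
    by blast
qed

end
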